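(* For every $k\ge 1$, $B_k'=\{[f,l]\mid f\in B_k,\ l\in G_k\}=\{[l,f]\mid f\in B_k,\ l\in G_k\}$.
   Context: $[a,b]=aba^{-1}b^{-1}$, and $G'=[G,G]$ is the derived subgroup. $C_2=\langle\sigma\rangle$ with $\sigma=(1,2)$. For a group $B$, elements of $B\wr C_2$ are written $(g_1,g_2)\pi$ with $g_1,g_2\in B$ and $\pi\in C_2$, with multiplication $(g_1,g_2)\pi_g\cdot(h_1,h_2)\pi_h=(g_1h_{\pi_g(1)},g_2h_{\pi_g(2)})\pi_g\pi_h$. Define recursively $B_1=C_2$ and $B_k=B_{k-1}\wr C_2$ for $k>1$. Define $G_1=\{e\}$ and $G_k=\{(g_1,g_2)\pi\in B_k \mid g_1g_2\in G_{k-1}\}$ for $k>1$. ($B_k$ is isomorphic to a Sylow 2-subgroup of $S_{2^k}$ and $G_k$ is isomorphic to a Sylow 2-subgroup of $A_{2^k}$.) *)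

theory Defs
  imports "HOL-Algebra.Sym_Groups" "HOL-Algebra.Weak_Morphisms"
begin

definition C2 :: "(nat \<Rightarrow> nat) monoid" where
  "C2 = subgroup_generated (sym_group 2) {transpose 1 2}"

definition coord :: "'a \<times> 'a \<Rightarrow> nat \<Rightarrow> 'a" where
  "coord h i = (if i = 1 then fst h else snd h)"

text \<open>The pair \<open>((g\<^sub>1, g\<^sub>2), \<pi>)\<close> stands for the element \<open>(g\<^sub>1, g\<^sub>2)\<pi>\<close> of \<open>B \<wr> C\<^sub>2\<close>.\<close>

definition wreath_C2 :: "('a, 'b) monoid_scheme \<Rightarrow> (('a \<times> 'a) \<times> (nat \<Rightarrow> nat)) monoid" where
  "wreath_C2 B =
     \<lparr>carrier = (carrier B \<times> carrier B) \<times> carrier C2,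
      monoid.mult = (\<lambda>((g1, g2), p) (h, q).
        ((g1 \<otimes>\<^bsub>B\<^esub> coord h (p 1), g2 \<otimes>\<^bsub>B\<^esub> coord h (p 2)), p \<otimes>\<^bsub>C2\<^esub> q)),
      one = ((\<one>\<^bsub>B\<^esub>, \<one>\<^bsub>B\<^esub>), \<one>\<^bsub>C2\<^esub>)\<rparr>"

text \<open>A single type for the elements of all iterated wreath products. The constructors are
  injective, so \<^const>\<open>image_group\<close> merely relabels elements below.\<close>

datatype wr = Base "nat \<Rightarrow> nat" | Wr "(wr \<times> wr) \<times> (nat \<Rightarrow> nat)"

text \<open>The index starts at 1; the value at 0 is unspecified in both recursions.\<close>

fun Bgrp :: "nat \<Rightarrow> wr monoid" where
  "Bgrp (Suc 0) = image_group Base C2"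
| "Bgrp (Suc (Suc k)) = image_group Wr (wreath_C2 (Bgrp (Suc k)))"

fun Gset :: "nat \<Rightarrow> wr set" where
  "Gset (Suc 0) = {\<one>\<^bsub>Bgrp (Suc 0)\<^esub>}"
| "Gset (Suc (Suc k)) =
     {Wr ((g1, g2), p) | g1 g2 p.
        Wr ((g1, g2), p) \<in> carrier (Bgrp (Suc (Suc k))) \<and>
        g1 \<otimes>\<^bsub>Bgrp (Suc k)\<^esub> g2 \<in> Gset (Suc k)}"

definition commutator :: "('a, 'b) monoid_scheme \<Rightarrow> 'a \<Rightarrow> 'a \<Rightarrow> 'a" where
  "commutator G a b = a \<otimes>\<^bsub>G\<^esub> b \<otimes>\<^bsub>G\<^esub> inv\<^bsub>G\<^esub> a \<otimes>\<^bsub>G\<^esub> inv\<^bsub>G\<^esub> b"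

lemma group_C2: "group C2"
  unfolding C2_def by (simp add: group.group_subgroup_generated sym_group_is_group)

lemma C2_mult: "p \<otimes>\<^bsub>C2\<^esub> q = p \<circ> q"
  by (simp add: C2_def subgroup_generated_def sym_group_def)

lemma C2_one: "\<one>\<^bsub>C2\<^esub> = id"
  by (simp add: C2_def subgroup_generated_def sym_group_def)

lemma carrier_C2: "carrier C2 = {id, transpose 1 2}"
proof
  let ?S = "sym_group 2" and ?t = "transpose 1 2 :: nat \<Rightarrow> nat"
  interpret S: group ?S by (rule sym_group_is_group)
  have t: "?t \<in> carrier ?S"
    by (simp add: sym_group_carrier permutes_swap_id)
  have i: "inv\<^bsub>?S\<^esub> ?t = ?t"
    by (rule S.inv_equality) (use t in \<open>auto simp: sym_group_mult sym_group_one\<close>)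
  have "subgroup {id, ?t} ?S"
    by (rule S.subgroupI)
       (use t i in \<open>auto simp: sym_group_mult sym_group_one sym_group_carrier
          permutes_id S.inv_one[unfolded sym_group_one]\<close>)
  then show "carrier C2 \<subseteq> {id, ?t}"
    unfolding C2_def carrier_subgroup_generated
    by (intro S.generate_subgroup_incl) auto
  show "{id, ?t} \<subseteq> carrier C2"
    unfolding C2_def carrier_subgroup_generated
    using t generate.one[of ?S] by (auto simp: sym_group_one intro: generate.incl)
qed

lemma group_wreath_C2:
  assumes "group B"
  shows "group (wreath_C2 B)"
proof -
  interpret B: group B by fact
  show ?thesis
  proof (rule groupI, goal_cases)
    case (1 x y)
    then show ?case
      by (auto simp: wreath_C2_def carrier_C2 C2_mult coord_def)
  next
    case 2
    then show ?case by (simp add: wreath_C2_def carrier_C2 C2_one)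
  next
    case (3 x y z)
    then show ?case
      by (auto simp: wreath_C2_def carrier_C2 C2_mult coord_def B.m_assoc)
  next
    case (4 x)
    then show ?case
      by (auto simp: wreath_C2_def C2_mult C2_one coord_def)
  next
    case (5 x)
    then obtain g1 g2 p where x: "x = ((g1, g2), p)" "g1 \<in> carrier B" "g2 \<in> carrier B"
      "p = id \<or> p = transpose 1 2"
      by (auto simp: wreath_C2_def carrier_C2)
    let ?y = "if p = id then ((inv\<^bsub>B\<^esub> g1, inv\<^bsub>B\<^esub> g2), p) else ((inv\<^bsub>B\<^esub> g2, inv\<^bsub>B\<^esub> g1), p)"
    show ?case
      by (rule bexI[of _ ?y])
         (use x in \<open>auto simp: wreath_C2_def carrier_C2 C2_mult C2_one coord_def\<close>)
  qed
qed

lemma group_Bgrp: "1 \<le> k \<Longrightarrow> group (Bgrp k)"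
proof (induction k rule: Bgrp.induct)
  case 1
  show ?case
    by (simp add: group.inj_imp_image_group_is_group[OF group_C2] inj_on_def)
next
  case (2 k)
  then show ?case
    by (simp add: group.inj_imp_image_group_is_group[OF group_wreath_C2] inj_on_def)
qed auto

end

theory Submission
  imports Defs
begin

text \<open>Induction on \<open>k\<close>. Let \<open>H = B\<^bsub>k-1\<^esub>\<close> and let \<open>a\<close>, \<open>b\<close> denote elements of \<open>H\<close>. The maps
  \<open>(a, b)\<pi> \<mapsto> \<pi>\<close> and \<open>(a, b)\<pi> \<mapsto> b a H'\<close> are homomorphisms from \<open>H \<wr> C\<^sub>2\<close> to abelian groups, so every
  element of the derived subgroup is of the form \<open>(a, b)\<close> with \<open>b a \<in> H'\<close>. By induction
  \<open>b a = [x, m]\<close> with \<open>m \<in> G\<^bsub>k-1\<^esub>\<close>, and then \<open>(a, b)\<close> is the commutator of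
  \<open>(a m x m\<^sup>-\<^sup>1, x)\<close> and \<open>(m, e)\<sigma>\<close>, where \<open>(m, e)\<sigma> \<in> G\<^sub>k\<close>. The second equality follows
  from the first because \<open>[l, f] = [f, l]\<^sup>-\<^sup>1\<close>.\<close>

text \<open>Cancelling \<open>l \<otimes> f\<close> on the right reduces a commutator identity to
  one between products, so no inverse in a wreath product has to be computed.\<close>

lemma (in group) commutator_eqI:
  assumes "f \<in> carrier G" "l \<in> carrier G" "z \<in> carrier G" "f \<otimes> l = z \<otimes> (l \<otimes> f)"
  shows "commutator G f l = z"
  using assms by (simp add: commutator_def m_assoc inv_mult_group[symmetric])

lemma (in group) inv_commutator:
  assumes "f \<in> carrier G" "l \<in> carrier G"
  shows "inv (commutator G f l) = commutator G l f"
  using assms by (simp add: commutator_def inv_mult_group m_assoc)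

lemma (in group) commutator_mult_swap:
  assumes "f \<in> carrier G" "l \<in> carrier G"
  shows "commutator G f l \<otimes> (l \<otimes> f) = f \<otimes> l"
  using assms by (simp add: commutator_def m_assoc flip: inv_mult_group)

lemma (in group) commutator_in_derived:
  assumes "f \<in> carrier G" "l \<in> carrier G"
  shows "commutator G f l \<in> derived G (carrier G)"
  unfolding derived_def commutator_def using assms by (intro generate.incl) auto

lemma (in group_hom) hom_commutator:
  assumes "f \<in> carrier G" "l \<in> carrier G"
  shows "h (commutator G f l) = commutator H (h f) (h l)"
  using assms by (simp add: commutator_def)

text \<open>The image of the derived subgroup is the derived subgroup of the image, which is trivial
  in an abelian group.\<close>

lemma (in group_hom) hom_derived_eq_one:
  assumes "comm_group H" "x \<in> derived G (carrier G)"
  shows "h x = \<one>\<^bsub>H\<^esub>"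
proof -
  have "h x \<in> derived H (h ` carrier G)"
    using assms(2) by (simp add: derived_img)
  also have "\<dots> = {\<one>\<^bsub>H\<^esub>}"
    by (rule comm_group.derived_eq_singleton[OF assms(1)]) auto
  finally show ?thesis by simp
qed

lemma (in group) derived_eq_commutators_inv:
  assumes "S \<subseteq> carrier G"
    and "derived G (carrier G) = {commutator G f l | f l. f \<in> carrier G \<and> l \<in> S}"
  shows "derived G (carrier G) = {commutator G l f | f l. f \<in> carrier G \<and> l \<in> S}"
proof
  interpret D: subgroup "derived G (carrier G)" G
    by (rule derived_is_subgroup) simp
  show "{commutator G l f | f l. f \<in> carrier G \<and> l \<in> S} \<subseteq> derived G (carrier G)"
    using assms(1) commutator_in_derived by blast
  show "derived G (carrier G) \<subseteq> {commutator G l f | f l. f \<in> carrier G \<and> l \<in> S}"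
  proof
    fix x assume x: "x \<in> derived G (carrier G)"
    then have "inv x \<in> derived G (carrier G)" by simp
    then obtain f l where fl: "f \<in> carrier G" "l \<in> S" "inv x = commutator G f l"
      unfolding assms(2) by blast
    have "x = inv (inv x)" using x by simp
    also have "\<dots> = commutator G l f"
      using fl assms(1) by (auto simp: inv_commutator)
    finally show "x \<in> {commutator G l f | f l. f \<in> carrier G \<and> l \<in> S}"
      using fl by blast
  qed
qed

text \<open>Injectivity makes \<open>h\<close> an isomorphism onto \<open>K\<close>, and
  homomorphisms preserve commutators. This carries results for \<open>C2\<close> and
  \<open>wreath_C2\<close> over to the groups relabelled by \<open>Base\<close> and
  \<open>Wr\<close>.\<close>

lemma derived_image_group:
  assumes "group G" "inj_on h (carrier G)" "S \<subseteq> carrier G"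
    and "derived G (carrier G) = {commutator G f l | f l. f \<in> carrier G \<and> l \<in> S}"
  defines "K \<equiv> image_group h G"
  shows "derived K (carrier K) = {commutator K f l | f l. f \<in> carrier K \<and> l \<in> h ` S}"
proof -
  have "group K"
    unfolding K_def by (rule group.inj_imp_image_group_is_group[OF assms(1,2)])
  moreover have "h \<in> hom G K"
    using inj_imp_image_group_iso[OF assms(2)] by (simp add: K_def iso_def)
  ultimately interpret group_hom G K h
    using assms(1) by (simp add: group_hom_def group_hom_axioms_def)
  have car: "carrier K = h ` carrier G"
    by (simp add: K_def image_group_carrier)
  have "derived K (carrier K) = h ` {commutator G f l | f l. f \<in> carrier G \<and> l \<in> S}"
    unfolding car assms(4)[symmetric] by (rule derived_img) simp
  also have "\<dots> = {h (commutator G f l) | f l. f \<in> carrier G \<and> l \<in> S}" by blast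
  also have "\<dots> = {commutator K (h f) (h l) | f l. f \<in> carrier G \<and> l \<in> S}"
    using assms(3) hom_commutator by (metis (no_types, opaque_lifting) subsetD)
  also have "\<dots> = {commutator K f l | f l. f \<in> carrier K \<and> l \<in> h ` S}"
    unfolding car by blast
  finally show ?thesis .
qed

lemma comm_group_C2: "comm_group C2"
  by (rule group.group_comm_groupI[OF group_C2]) (auto simp: carrier_C2 C2_mult)

lemma derived_wreath_C2_D:
  assumes "group B" "((a, b), p) \<in> derived (wreath_C2 B) (carrier (wreath_C2 B))"
  shows "a \<in> carrier B" "b \<in> carrier B" "p = id" "b \<otimes>\<^bsub>B\<^esub> a \<in> derived B (carrier B)"
proof -
  interpret B: group B by fact
  interpret W: group "wreath_C2 B" by (rule group_wreath_C2) fact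
  interpret N: normal "derived B (carrier B)" B by (rule B.derived_self_is_normal)
  let ?Q = "B Mod derived B (carrier B)"
  let ?q = "\<lambda>x. derived B (carrier B) #>\<^bsub>B\<^esub> x"
  have Q: "comm_group ?Q" by (rule B.derived_quot_is_comm_group)
  interpret Q: comm_group ?Q by (rule Q)
  interpret q: group_hom B ?Q ?q
    using N.r_coset_hom_Mod by unfold_locales auto
  have "((a, b), p) \<in> carrier (wreath_C2 B)"
    using assms(2) W.derived_in_carrier by blast
  then show ab: "a \<in> carrier B" "b \<in> carrier B" by (auto simp: wreath_C2_def)
  interpret s: group_hom "wreath_C2 B" C2 snd
    by (intro group_hom.intro group_hom_axioms.intro homI W.group_axioms group_C2)
       (auto simp: wreath_C2_def)
  show "p = id"
    using s.hom_derived_eq_one[OF comm_group_C2 assms(2)] by (simp add: C2_one)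
  \<comment> \<open>The coordinates of a product combine those of both factors, with those of the
    second possibly exchanged. The exchange is invisible in the abelian group
    \<open>?Q\<close>.\<close>
  interpret d: group_hom "wreath_C2 B" ?Q "\<lambda>x. ?q (snd (fst x) \<otimes>\<^bsub>B\<^esub> fst (fst x))"
  proof (intro group_hom.intro group_hom_axioms.intro homI W.group_axioms Q.group_axioms)
    fix x assume "x \<in> carrier (wreath_C2 B)"
    then show "?q (snd (fst x) \<otimes>\<^bsub>B\<^esub> fst (fst x)) \<in> carrier ?Q"
      by (intro q.hom_closed) (auto simp: wreath_C2_def)
  next
    fix x y assume "x \<in> carrier (wreath_C2 B)" "y \<in> carrier (wreath_C2 B)"
    then show "?q (snd (fst (x \<otimes>\<^bsub>wreath_C2 B\<^esub> y)) \<otimes>\<^bsub>B\<^esub> fst (fst (x \<otimes>\<^bsub>wreath_C2 B\<^esub> y))) =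
      ?q (snd (fst x) \<otimes>\<^bsub>B\<^esub> fst (fst x)) \<otimes>\<^bsub>?Q\<^esub> ?q (snd (fst y) \<otimes>\<^bsub>B\<^esub> fst (fst y))"
      by (auto simp: wreath_C2_def carrier_C2 coord_def q.hom_mult Q.m_ac
          simp del: mult_FactGroup)
  qed
  \<comment> \<open>The unit of \<open>?Q\<close> is the derived subgroup itself, and
    \<open>b a\<close> lies in its own coset.\<close>
  have "?q (b \<otimes>\<^bsub>B\<^esub> a) = derived B (carrier B)"
    using d.hom_derived_eq_one[OF Q assms(2)] by simp
  then show "b \<otimes>\<^bsub>B\<^esub> a \<in> derived B (carrier B)"
    using ab B.rcos_self[OF _ N.subgroup_axioms, of "b \<otimes>\<^bsub>B\<^esub> a"] by simp
qed

text \<open>This is the induction step before relabelling: if \<open>S\<close> is the set for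
  \<open>B\<close>, the set that \<open>l\<close> ranges over is the one for
  \<open>B \<wr> C\<^sub>2\<close>.\<close>

lemma derived_wreath_C2:
  assumes "group B" "S \<subseteq> carrier B"
    and IH: "derived B (carrier B) = {commutator B f l | f l. f \<in> carrier B \<and> l \<in> S}"
  defines "W \<equiv> wreath_C2 B"
  shows "derived W (carrier W) =
    {commutator W f l | f l. f \<in> carrier W \<and>
       l \<in> {((g1, g2), p) | g1 g2 p. ((g1, g2), p) \<in> carrier W \<and> g1 \<otimes>\<^bsub>B\<^esub> g2 \<in> S}}"
    (is "_ = {_ | f l. _ \<and> l \<in> ?T}")
proof
  interpret B: group B by fact
  interpret W: group W unfolding W_def by (rule group_wreath_C2) fact
  show "{commutator W f l | f l. f \<in> carrier W \<and> l \<in> ?T} \<subseteq> derived W (carrier W)"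
    using W.commutator_in_derived by blast
  show "derived W (carrier W) \<subseteq> {commutator W f l | f l. f \<in> carrier W \<and> l \<in> ?T}"
  proof
    fix z assume z: "z \<in> derived W (carrier W)"
    obtain a b p where z_eq: "z = ((a, b), p)" by (metis surj_pair)
    note D = derived_wreath_C2_D[OF assms(1) z[unfolded z_eq W_def]]
    obtain x m where x: "x \<in> carrier B" and "m \<in> S" and ba: "b \<otimes>\<^bsub>B\<^esub> a = commutator B x m"
      using D(4) unfolding IH by blast
    then have m: "m \<in> carrier B" using assms(2) by blast
    \<comment> \<open>Write \<open>f = (c, x)\<close> and \<open>l = (m, e)\<sigma>\<close>. Then
      \<open>f l = (c m, x)\<sigma>\<close> and \<open>z l f = (a m x, b c)\<sigma>\<close>. The
      first coordinates force \<open>c = a m x m^-1\<close>; the second then require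
      \<open>b c = x\<close>, which is \<open>b a = [x, m]\<close>.\<close>
    let ?f = "((a \<otimes>\<^bsub>B\<^esub> m \<otimes>\<^bsub>B\<^esub> x \<otimes>\<^bsub>B\<^esub> inv\<^bsub>B\<^esub> m, x), id)"
    let ?l = "((m, \<one>\<^bsub>B\<^esub>), transpose 1 2)"
    have f: "?f \<in> carrier W" and l: "?l \<in> ?T"
      using D x m \<open>m \<in> S\<close> by (auto simp: W_def wreath_C2_def carrier_C2)
    have "b \<otimes>\<^bsub>B\<^esub> (a \<otimes>\<^bsub>B\<^esub> m \<otimes>\<^bsub>B\<^esub> x \<otimes>\<^bsub>B\<^esub> inv\<^bsub>B\<^esub> m) = (b \<otimes>\<^bsub>B\<^esub> a) \<otimes>\<^bsub>B\<^esub> (m \<otimes>\<^bsub>B\<^esub> x) \<otimes>\<^bsub>B\<^esub> inv\<^bsub>B\<^esub> m"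
      using D x m by (simp add: B.m_assoc)
    also have "\<dots> = x"
      using x m by (simp add: ba B.commutator_mult_swap B.m_assoc)
    finally have bx: "b \<otimes>\<^bsub>B\<^esub> (a \<otimes>\<^bsub>B\<^esub> m \<otimes>\<^bsub>B\<^esub> x \<otimes>\<^bsub>B\<^esub> inv\<^bsub>B\<^esub> m) = x" .
    have "commutator W ?f ?l = z"
    proof (rule W.commutator_eqI)
      show "z \<in> carrier W" using z W.derived_in_carrier by blast
      show "?f \<otimes>\<^bsub>W\<^esub> ?l = z \<otimes>\<^bsub>W\<^esub> (?l \<otimes>\<^bsub>W\<^esub> ?f)"
        using D x m bx
        by (simp add: z_eq W_def wreath_C2_def coord_def C2_mult B.m_assoc)
    qed (use f l in auto)
    then show "z \<in> {commutator W f l | f l. f \<in> carrier W \<and> l \<in> ?T}"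
      using f l by blast
  qed
qed

lemma Gset_subset_carrier: "1 \<le> k \<Longrightarrow> Gset k \<subseteq> carrier (Bgrp k)"
  by (induction k rule: Bgrp.induct)
     (auto simp: image_group_carrier image_group_one C2_one carrier_C2)

lemma derived_Bgrp:
  assumes "1 \<le> k"
  shows "derived (Bgrp k) (carrier (Bgrp k)) =
    {commutator (Bgrp k) f l | f l. f \<in> carrier (Bgrp k) \<and> l \<in> Gset k}"
  using assms
proof (induction k rule: Bgrp.induct)
  case 1
  interpret C: comm_group C2 by (rule comm_group_C2)
  have "derived C2 (carrier C2) = {commutator C2 f l | f l. f \<in> carrier C2 \<and> l \<in> {\<one>\<^bsub>C2\<^esub>}}"
    \<comment> \<open>Both sides are trivial as \<open>C2\<close> is abelian; the witness shows that
      the right side contains the unit.\<close>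
    by (auto simp: C.derived_eq_singleton commutator_def intro!: exI[of _ "\<one>\<^bsub>C2\<^esub>"])
  from derived_image_group[OF group_C2 _ _ this, of Base] show ?case
    by (simp add: image_group_one inj_on_def)
next
  case (2 k)
  let ?B = "Bgrp (Suc k)" and ?W = "wreath_C2 (Bgrp (Suc k))"
  let ?T = "{((g1, g2), p) | g1 g2 p. ((g1, g2), p) \<in> carrier ?W \<and> g1 \<otimes>\<^bsub>?B\<^esub> g2 \<in> Gset (Suc k)}"
  have B: "group ?B" by (rule group_Bgrp) simp
  \<comment> \<open>Pulling the constructor out gives the image form that the transfer along
    \<open>Wr\<close> expects.\<close>
  have T: "Gset (Suc (Suc k)) = Wr ` ?T"
    by (auto simp: image_group_carrier)
  have "derived ?W (carrier ?W) = {commutator ?W f l | f l. f \<in> carrier ?W \<and> l \<in> ?T}"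
    using 2 by (intro derived_wreath_C2 B Gset_subset_carrier) auto
  moreover have "?T \<subseteq> carrier ?W" by blast
  moreover have "inj_on Wr (carrier ?W)" by (simp add: inj_on_def)
  ultimately show ?case
    unfolding T Bgrp.simps by (intro derived_image_group group_wreath_C2 B)
\<comment> \<open>The remaining case is index 0, excluded by \<open>1 \<le> k\<close>.\<close>
qed auto

theorem theorem14:
  fixes k :: nat
  assumes "k \<ge> 1"
  shows "derived (Bgrp k) (carrier (Bgrp k)) =
           {commutator (Bgrp k) f l | f l. f \<in> carrier (Bgrp k) \<and> l \<in> Gset k}
       \<and> derived (Bgrp k) (carrier (Bgrp k)) =
           {commutator (Bgrp k) l f | f l. f \<in> carrier (Bgrp k) \<and> l \<in> Gset k}"
  using derived_Bgrp[OF assms] Gset_subset_carrier[OF assms]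
    group.derived_eq_commutators_inv[OF group_Bgrp[OF assms]] by blast

end
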